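(* Let $d\ge 2$ and let a signal $F\in\bar{\mathcal{P}}_d$ be $(\eta,\gamma)$-regular. Then for each integer $l$ with $0\le l<d$ and each $\tilde F\in\mathcal{P}_l$, $$\|\bar m(F)-\bar m(\tilde F)\|\ \ge\ \theta:=\min\left(1,\ \frac{\eta^{d(d-1)}\,\gamma^d\,\prod_{i=1}^{d-1}(i!)^2}{\sqrt{2d-1}\;d^2\;d!\;(d+1)^{d-1}}\right).$$
   Context: For $n\ge 1$, $\mathcal{P}_n=\{(a,x)=(a_1,\ldots,a_n,x_1,\ldots,x_n)\in\mathbb{R}^{2n} : x_1<\cdots<x_n,\ a_i\neq 0,\ i=1,\ldots,n\}$; a tuple $(a,x)\in\mathcal{P}_n$ is identified with the signal $G(x)=\sum_{j=1}^n a_j\delta(x-x_j)$ with $n$ nodes. $\mathcal{P}_0$ is the singleton containing the zero signal. $\bar{\mathcal{P}}_d\subset\mathcal{P}_d$ is the set of signals for which $|x_j|\le 1$ and $|a_j|\le 1$ for all $j=1,\ldots,d$ (no such bounds are assumed for $\tilde F$). The moments of a signal $G=(a,x)\in\mathcal{P}_n$ are $m_k(G)=\sum_{j=1}^n a_jx_j^k$, $k\ge 0$ (with $x_j^0=1$); all moments of the zero signal are $0$. For any signal $G$, $\bar m(G)=(m_0(G),\ldots,m_{2d-2}(G))\in\mathbb{R}^{2d-1}$, and $\|\cdot\|$ is the Euclidean norm. For $0<\eta\le\frac{2}{d-1}$ and $0<\gamma\le 1$, a signal $F=(a,x)\in\bar{\mathcal{P}}_d$ is called $(\eta,\gamma)$-regular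 if $x_{j+1}-x_j\ge\eta$ for $j=1,\ldots,d-1$ and $|a_j|\ge\gamma$ for $j=1,\ldots,d$. *)

theory Defs
  imports "HOL-Analysis.Analysis"
begin

(* The amplitudes a and the nodes x of a signal are lists, so that the number of nodes can
   vary within a statement; the entries a_1, ..., a_n are a ! 0, ..., a ! (n - 1). *)
type_synonym signal = "real list \<times> real list"

definition signals :: "nat \<Rightarrow> signal set" where
  "signals n = {(a, x). length a = n \<and> length x = n \<and>
     sorted_wrt (<) x \<and> (\<forall>i<n. a ! i \<noteq> 0)}"

definition bounded_signals :: "nat \<Rightarrow> signal set" where
  "bounded_signals d = {(a, x) \<in> signals d. \<forall>j<d. \<bar>x ! j\<bar> \<le> 1 \<and> \<bar>a ! j\<bar> \<le> 1}"

(* For the zero signal ([], []) the sum is empty. *)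
definition moment :: "nat \<Rightarrow> signal \<Rightarrow> real" where
  "moment k G = (case G of (a, x) \<Rightarrow> \<Sum>j<length a. a ! j * (x ! j) ^ k)"

definition regular_signal :: "nat \<Rightarrow> real \<Rightarrow> real \<Rightarrow> signal \<Rightarrow> bool" where
  "regular_signal d \<eta> \<gamma> F \<longleftrightarrow> F \<in> bounded_signals d \<and>
     (case F of (a, x) \<Rightarrow>
       (\<forall>j. Suc j < d \<longrightarrow> x ! Suc j - x ! j \<ge> \<eta>) \<and> (\<forall>j<d. \<bar>a ! j\<bar> \<ge> \<gamma>))"

(* The Euclidean norm of the difference of the vectors (m_0, ..., m_{2d-2}) of two signals;
   L2_set f A is the square root of the sum over A of the squares of f, and is what the norm
   on real ^ 'n is defined by. *)
definition moment_dist :: "nat \<Rightarrow> signal \<Rightarrow> signal \<Rightarrow> real" where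
  "moment_dist d F G = L2_set (\<lambda>k. moment k F - moment k G) {0..2 * d - 2}"

end

theory Submission
  imports Defs "Jordan_Normal_Form.Determinant"
begin

text \<open>The Hankel matrix of the moments \<open>m\<^sub>0, \<dots>, m\<^bsub>2d-2\<^esub>\<close> of a signal factors as
  \<open>V\<^sup>T D V\<close> with \<open>V\<close> the Vandermonde matrix of the nodes and \<open>D\<close> the diagonal matrix of the
  amplitudes. Its determinant, the product of the amplitudes times the squared Vandermonde
  determinant, is bounded away from zero for a regular signal with \<open>d\<close> nodes, and vanishes for
  fewer than \<open>d\<close> nodes (pad with zero amplitudes). On the other hand, the Leibniz formula shows
  that the determinant changes little when the entries do.\<close>

section \<open>Vandermonde and Hankel determinants\<close>

definition newton_poly :: "(nat \<Rightarrow> 'a::comm_ring_1) \<Rightarrow> nat \<Rightarrow> 'a poly" where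
  "newton_poly x j = (\<Prod>i<j. [:- x i, 1:])"

lemma poly_newton_poly: "poly (newton_poly x j) t = (\<Prod>i<j. t - x i)"
  by (simp add: newton_poly_def poly_prod)

lemma
  fixes x :: "nat \<Rightarrow> 'a::idom"
  shows degree_newton_poly: "degree (newton_poly x j) = j"
    and lead_coeff_newton_poly: "coeff (newton_poly x j) j = 1"
proof -
  show deg: "degree (newton_poly x j) = j"
    unfolding newton_poly_def by (subst degree_prod_sum_eq) auto
  have "lead_coeff (newton_poly x j) = 1"
    unfolding newton_poly_def by (subst lead_coeff_prod) auto
  then show "coeff (newton_poly x j) j = 1"
    by (simp add: deg)
qed

text \<open>Passing from the monomials to the Newton basis is a unitriangular column operation that
  makes the matrix lower triangular.\<close>
lemma det_vandermonde:
  fixes x :: "nat \<Rightarrow> 'a::idom"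
  shows "Determinant.det (mat n n (\<lambda>(i, j). x i ^ j)) = (\<Prod>j<n. \<Prod>i<j. x j - x i)"
proof -
  let ?V = "mat n n (\<lambda>(i, j). x i ^ j)"
  \<comment> \<open>Column \<open>j\<close> of \<open>C\<close> holds the coefficients of the
    \<open>j\<close>-th Newton polynomial, so multiplying by \<open>C\<close> evaluates these
    polynomials at the nodes.\<close>
  define C where "C = mat n n (\<lambda>(k, j). coeff (newton_poly x j) k)"
  define N where "N = mat n n (\<lambda>(i, j). poly (newton_poly x j) (x i))"
  have "?V * C = N"
  proof (rule eq_matI)
    fix i j assume "i < dim_row N" "j < dim_col N"
    then have ij: "i < n" "j < n" by (auto simp: N_def)
    have "(?V * C) $$ (i, j) = (\<Sum>k\<in>{0..<n}. x i ^ k * coeff (newton_poly x j) k)"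
      using ij by (simp add: C_def scalar_prod_def)
    also have "\<dots> = (\<Sum>k\<le>j. x i ^ k * coeff (newton_poly x j) k)"
      using ij by (intro sum.mono_neutral_right)
        (auto simp: degree_newton_poly intro!: coeff_eq_0)
    also have "\<dots> = N $$ (i, j)"
      using ij by (simp add: N_def poly_altdef degree_newton_poly mult.commute)
    finally show "(?V * C) $$ (i, j) = N $$ (i, j)" .
  qed (auto simp: C_def N_def)
  then have "Determinant.det N = Determinant.det ?V * Determinant.det C"
    using Determinant.det_mult[of ?V n C] by (simp add: C_def)
  moreover have "Determinant.det C = 1"
  proof -
    have "upper_triangular C"
      by (auto simp: upper_triangular_def C_def degree_newton_poly intro!: coeff_eq_0)
    then have "Determinant.det C = prod_list (diag_mat C)"
      by (rule Determinant.det_upper_triangular[where n = n]) (simp add: C_def)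
    also have "diag_mat C = map (\<lambda>_. 1) [0..<n]"
      by (simp add: diag_mat_def C_def lead_coeff_newton_poly)
    finally show ?thesis by (simp add: map_replicate_const)
  qed
  moreover have "Determinant.det N = (\<Prod>j<n. \<Prod>i<j. x j - x i)"
  proof -
    \<comment> \<open>Above the diagonal, \<open>i < j\<close>, the entry contains the factor
      \<open>x i - x i\<close>.\<close>
    have "Determinant.det N = prod_list (diag_mat N)"
      by (rule Determinant.det_lower_triangular[where n = n])
        (auto simp: N_def poly_newton_poly)
    also have "diag_mat N = map (\<lambda>j. \<Prod>i<j. x j - x i) [0..<n]"
      by (simp add: diag_mat_def N_def poly_newton_poly)
    finally show ?thesis
      by (simp add: prod.distinct_set_conv_list[symmetric] atLeast0LessThan)
  qed
  ultimately show ?thesis by simp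
qed

text \<open>Stated for arbitrary \<open>a\<close> and \<open>x\<close>, so that it also covers power
  sums padded with zero amplitudes.\<close>

lemma det_hankel_power_sums:
  fixes a x :: "nat \<Rightarrow> 'a::idom"
  shows "Determinant.det (mat n n (\<lambda>(i, j). \<Sum>k<n. a k * x k ^ (i + j))) =
    (\<Prod>k<n. a k) * (\<Prod>j<n. \<Prod>i<j. x j - x i)\<^sup>2"
proof -
  define V where "V = mat n n (\<lambda>(i, j). x i ^ j)"
  define D where "D = mat n n (\<lambda>(i, j). if i = j then a i else 0)"
  \<comment> \<open>The explicit form of \<open>D * V\<close>, which leaves a single sum in each
    entry of the triple product.\<close>
  define W where "W = mat n n (\<lambda>(i, j). a i * x i ^ j)"
  have carr: "V \<in> carrier_mat n n" "V\<^sup>T \<in> carrier_mat n n" "D \<in> carrier_mat n n"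
    by (auto simp: V_def D_def)
  have "D * V = W"
    by (rule eq_matI) (auto simp: D_def V_def W_def scalar_prod_def if_distrib[of "\<lambda>z. z * _"]
        sum.delta cong: if_cong)
  moreover have "V\<^sup>T * W = mat n n (\<lambda>(i, j). \<Sum>k<n. a k * x k ^ (i + j))"
    by (rule eq_matI) (auto simp: V_def W_def scalar_prod_def power_add atLeast0LessThan
        mult_ac intro!: sum.cong)
  ultimately have "Determinant.det (mat n n (\<lambda>(i, j). \<Sum>k<n. a k * x k ^ (i + j))) =
      Determinant.det (V\<^sup>T * (D * V))" by simp
  also have "\<dots> = Determinant.det D * (Determinant.det V)\<^sup>2"
    using carr by (simp add: Determinant.det_mult[of _ n] Determinant.det_transpose[of _ n]
        power2_eq_square mult_ac)
  also have "Determinant.det D = (\<Prod>k<n. a k)"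
  proof -
    have "Determinant.det D = prod_list (diag_mat D)"
      by (rule Determinant.det_lower_triangular[where n = n]) (auto simp: D_def)
    also have "diag_mat D = map a [0..<n]"
      by (simp add: diag_mat_def D_def)
    finally show ?thesis
      by (simp add: prod.distinct_set_conv_list[symmetric] atLeast0LessThan)
  qed
  finally show ?thesis
    by (simp add: V_def det_vandermonde)
qed

section \<open>Perturbation of determinants\<close>

text \<open>Exchanging the factors one at a time costs at most \<open>\<delta>\<close> times
  \<open>card A - 1\<close> remaining factors of size at most \<open>M\<close> per exchange.\<close>

lemma abs_prod_diff_le:
  fixes f g :: "'b \<Rightarrow> 'a::linordered_idom"
  assumes "finite A"
    and "\<And>i. i \<in> A \<Longrightarrow> \<bar>f i\<bar> \<le> M" "\<And>i. i \<in> A \<Longrightarrow> \<bar>g i\<bar> \<le> M"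
    and "\<And>i. i \<in> A \<Longrightarrow> \<bar>f i - g i\<bar> \<le> \<delta>"
  shows "\<bar>(\<Prod>i\<in>A. f i) - (\<Prod>i\<in>A. g i)\<bar> \<le> of_nat (card A) * \<delta> * M ^ (card A - 1)"
  using assms
proof (induction A rule: finite_induct)
  case (insert b A)
  let ?P = "\<Prod>i\<in>A. f i" and ?Q = "\<Prod>i\<in>A. g i"
  have M: "0 \<le> M" and \<delta>: "0 \<le> \<delta>"
    using insert.prems(1)[of b] insert.prems(3)[of b] abs_ge_zero order_trans by blast+
  have IH: "\<bar>?P - ?Q\<bar> \<le> of_nat (card A) * \<delta> * M ^ (card A - 1)"
    using insert.prems by (intro insert.IH) auto
  have "\<bar>?Q\<bar> \<le> (\<Prod>i\<in>A. M)"
    unfolding abs_prod using insert.prems(2) by (intro prod_mono) simp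
  then have "\<bar>?Q\<bar> \<le> M ^ card A"
    by simp
  then have "\<bar>f b - g b\<bar> * \<bar>?Q\<bar> \<le> \<delta> * M ^ card A"
    using insert.prems(3) \<delta> by (intro mult_mono) auto
  moreover have "\<bar>f b\<bar> * \<bar>?P - ?Q\<bar> \<le> M * (of_nat (card A) * \<delta> * M ^ (card A - 1))"
    using insert.prems(1) M IH by (intro mult_mono) auto
  \<comment> \<open>The case \<open>card A = 0\<close> is separate because \<open>card A - 1\<close>
    is then truncated; both sides vanish.\<close>
  moreover have "M * (of_nat (card A) * \<delta> * M ^ (card A - 1)) = of_nat (card A) * \<delta> * M ^ card A"
    by (cases "card A") (auto simp: mult_ac)
  moreover have "f b * ?P - g b * ?Q = f b * (?P - ?Q) + (f b - g b) * ?Q"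
    by (simp add: algebra_simps)
  then have "\<bar>f b * ?P - g b * ?Q\<bar> \<le> \<bar>f b\<bar> * \<bar>?P - ?Q\<bar> + \<bar>f b - g b\<bar> * \<bar>?Q\<bar>"
    using abs_triangle_ineq[of "f b * (?P - ?Q)" "(f b - g b) * ?Q"] by (simp add: abs_mult)
  ultimately have "\<bar>f b * ?P - g b * ?Q\<bar> \<le> of_nat (card A) * \<delta> * M ^ card A + \<delta> * M ^ card A"
    by linarith
  then show ?case
    using insert.hyps by (simp add: algebra_simps)
qed simp

text \<open>The Leibniz formula has \<open>fact n\<close> terms, each a product of \<open>n\<close>
  entries up to sign, and \<open>abs_prod_diff_le\<close> bounds the change of each.\<close>

lemma abs_det_diff_le:
  fixes A B :: "'a::linordered_idom mat"
  assumes AB: "A \<in> carrier_mat n n" "B \<in> carrier_mat n n"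
    and "\<And>i j. i < n \<Longrightarrow> j < n \<Longrightarrow> \<bar>A $$ (i, j)\<bar> \<le> M"
    and "\<And>i j. i < n \<Longrightarrow> j < n \<Longrightarrow> \<bar>B $$ (i, j)\<bar> \<le> M"
    and "\<And>i j. i < n \<Longrightarrow> j < n \<Longrightarrow> \<bar>A $$ (i, j) - B $$ (i, j)\<bar> \<le> \<delta>"
  shows "\<bar>Determinant.det A - Determinant.det B\<bar> \<le> fact n * (of_nat n * \<delta> * M ^ (n - 1))"
proof -
  let ?S = "{p. p permutes {0..<n}}"
  let ?P = "\<lambda>A p. \<Prod>i = 0..<n. A $$ (i, p i)"
  have "\<bar>Determinant.det A - Determinant.det B\<bar> = \<bar>\<Sum>p\<in>?S. signof p * (?P A p - ?P B p)\<bar>"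
    by (simp add: det_def'[OF AB(1)] det_def'[OF AB(2)] sum_subtractf right_diff_distrib)
  also have "\<dots> \<le> (\<Sum>p\<in>?S. \<bar>signof p * (?P A p - ?P B p)\<bar>)"
    by (rule sum_abs)
  also have "\<dots> \<le> (\<Sum>p\<in>?S. of_nat n * \<delta> * M ^ (n - 1))"
  proof (rule sum_mono)
    fix p assume "p \<in> ?S"
    then have "p i < n" if "i < n" for i
      using that permutes_in_image[of p "{0..<n}" i] by auto
    then have "\<bar>?P A p - ?P B p\<bar> \<le> of_nat n * \<delta> * M ^ (n - 1)"
      using abs_prod_diff_le[of "{0..<n}" "\<lambda>i. A $$ (i, p i)" M "\<lambda>i. B $$ (i, p i)" \<delta>] assms
      by auto
    then show "\<bar>signof p * (?P A p - ?P B p)\<bar> \<le> of_nat n * \<delta> * M ^ (n - 1)"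
      by (simp add: abs_mult sign_def)
  qed
  also have "\<dots> = fact n * (of_nat n * \<delta> * M ^ (n - 1))"
    by (simp add: card_permutations[of _ n])
  finally show ?thesis .
qed

section \<open>Lower bound for the Vandermonde product of separated nodes\<close>

lemma separated_nodes_diff_ge:
  fixes x :: "nat \<Rightarrow> 'a::linordered_idom"
  assumes "\<And>j. Suc j < n \<Longrightarrow> x (Suc j) - x j \<ge> \<eta>" and "i + k < n"
  shows "x (i + k) - x i \<ge> of_nat k * \<eta>"
  using assms(2)
proof (induction k)
  case (Suc k)
  then show ?case using assms(1)[of "i + k"] by (simp add: algebra_simps)
qed simp

text \<open>Nodes whose indices differ by \<open>j - i\<close> are at least
  \<open>(j - i) * \<eta>\<close> apart, and for fixed \<open>j\<close> the numbers
  \<open>j - i\<close> run through 1, ..., \<open>j\<close>.\<close>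

lemma vandermonde_separated_ge:
  fixes x :: "nat \<Rightarrow> 'a::linordered_idom"
  assumes sep: "\<And>j. Suc j < n \<Longrightarrow> x (Suc j) - x j \<ge> \<eta>" and \<eta>: "\<eta> \<ge> 0"
  shows "(\<Prod>j<n. \<Prod>i<j. x j - x i) \<ge> (\<Prod>j<n. \<eta> ^ j * fact j)"
proof (rule prod_mono, intro conjI)
  fix j assume j: "j \<in> {..<n}"
  have "\<eta> ^ j * fact j = (\<Prod>i<j. of_nat (j - i) * \<eta>)"
    by (simp add: prod.distrib fact_prod_rev atLeast0LessThan mult.commute)
  also have "\<dots> \<le> (\<Prod>i<j. x j - x i)"
  proof (rule prod_mono, intro conjI)
    fix i assume "i \<in> {..<j}"
    then show "of_nat (j - i) * \<eta> \<le> x j - x i"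
      using separated_nodes_diff_ge[where x = x and n = n and i = i and k = "j - i", OF sep] j
      by auto
  qed (use \<eta> in simp)
  finally show "\<eta> ^ j * fact j \<le> (\<Prod>i<j. x j - x i)" .
qed (use \<eta> in simp)

text \<open>The exponents \<open>2 * j\<close> for \<open>j < n\<close> add up to
  \<open>n * (n - 1)\<close>, and the factor for \<open>j = 0\<close> is 1. This brings the squared
  bound into the shape used in the theorem.\<close>

lemma prod_power_fact_square:
  "(\<Prod>j<n. \<eta> ^ j * fact j)\<^sup>2 =
    (\<eta> :: 'a::{comm_semiring_1,semiring_char_0}) ^ (n * (n - 1)) * (\<Prod>i = 1..n - 1. (fact i)\<^sup>2)"
proof (induction n)
  case (Suc n)
  have "\<eta> ^ (Suc n * n) = \<eta> ^ (n * (n - 1)) * (\<eta> ^ n)\<^sup>2"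
  proof -
    have "Suc n * n = n * (n - 1) + n * 2"
      by (cases n) simp_all
    then show ?thesis
      by (simp only: power_add power_mult)
  qed
  moreover have "(\<Prod>i = 1..n. (fact i)\<^sup>2) = (\<Prod>i = 1..n - 1. (fact i)\<^sup>2) * (fact n :: 'a)\<^sup>2"
    by (cases n) simp_all
  ultimately show ?case
    using Suc by (simp add: power_mult_distrib mult_ac)
qed simp

section \<open>Hankel matrices of signals\<close>

text \<open>For \<open>d > 0\<close> the index \<open>i + j\<close> ranges over 0, ...,
  \<open>2 * d - 2\<close>, exactly the moments that enter \<open>moment_dist\<close>.\<close>

definition hankel :: "nat \<Rightarrow> signal \<Rightarrow> real mat" where
  "hankel d F = mat d d (\<lambda>(i, j). moment (i + j) F)"

lemma det_hankel:
  assumes "(a, x) \<in> signals d"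
  shows "Determinant.det (hankel d (a, x)) =
    (\<Prod>k<d. a ! k) * (\<Prod>j<d. \<Prod>i<j. x ! j - x ! i)\<^sup>2"
  using assms det_hankel_power_sums[of d "\<lambda>k. a ! k" "\<lambda>k. x ! k"]
  by (simp add: hankel_def moment_def signals_def)

lemma det_hankel_eq_0:
  assumes "F \<in> signals l" "l < d"
  shows "Determinant.det (hankel d F) = 0"
proof -
  obtain a x where F: "F = (a, x)" "length a = l"
    using assms by (auto simp: signals_def)
  \<comment> \<open>For \<open>k \<ge> l\<close> the list entry \<open>x ! k\<close> is unspecified,
    but it only occurs with coefficient 0.\<close>
  define b where "b k = (if k < l then a ! k else 0)" for k
  have "moment n F = (\<Sum>k<d. b k * x ! k ^ n)" for n
    unfolding moment_def F using assms(2) F(2)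
    by (simp, intro sum.mono_neutral_cong_left) (auto simp: b_def)
  then have "Determinant.det (hankel d F) =
      (\<Prod>k<d. b k) * (\<Prod>j<d. \<Prod>i<j. x ! j - x ! i)\<^sup>2"
    by (simp add: hankel_def det_hankel_power_sums)
  moreover have "(\<Prod>k<d. b k) = 0"
    using assms(2) by (auto simp: b_def intro!: bexI[of _ l])
  ultimately show ?thesis by simp
qed

text \<open>Both factors of \<open>det_hankel\<close> are bounded below: the amplitudes by
  \<open>\<gamma> ^ d\<close>, the squared Vandermonde product by the separation of the
  nodes.\<close>

lemma det_hankel_regular_ge:
  assumes "regular_signal d \<eta> \<gamma> F" "0 \<le> \<eta>" "0 \<le> \<gamma>"
  shows "\<bar>Determinant.det (hankel d F)\<bar> \<ge>
    \<eta> ^ (d * (d - 1)) * \<gamma> ^ d * (\<Prod>i = 1..d - 1. (fact i)\<^sup>2)"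
proof -
  obtain a x where F: "F = (a, x)" by (cases F)
  have sig: "(a, x) \<in> signals d"
    and sep: "\<And>j. Suc j < d \<Longrightarrow> x ! Suc j - x ! j \<ge> \<eta>"
    and amp: "\<And>j. j < d \<Longrightarrow> \<bar>a ! j\<bar> \<ge> \<gamma>"
    using assms(1) by (auto simp: F regular_signal_def bounded_signals_def)
  have "(\<Prod>k<d. \<gamma>) \<le> (\<Prod>k<d. \<bar>a ! k\<bar>)"
    using amp assms(3) by (intro prod_mono) auto
  moreover have "(\<Prod>j<d. \<eta> ^ j * fact j)\<^sup>2 \<le> (\<Prod>j<d. \<Prod>i<j. x ! j - x ! i)\<^sup>2"
    using vandermonde_separated_ge[where x = "\<lambda>j. x ! j" and n = d, OF sep assms(2)] assms(2)
    by (intro power_mono prod_nonneg) auto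
  ultimately have "\<gamma> ^ d * (\<Prod>j<d. \<eta> ^ j * fact j)\<^sup>2 \<le> \<bar>Determinant.det (hankel d F)\<bar>"
    unfolding F det_hankel[OF sig] abs_mult abs_prod using assms(3)
    by (simp, intro mult_mono) (auto intro!: prod_nonneg)
  then show ?thesis
    unfolding prod_power_fact_square by (simp only: mult_ac)
qed

lemma abs_moment_le:
  assumes "F \<in> bounded_signals d"
  shows "\<bar>moment k F\<bar> \<le> d"
proof -
  obtain a x where F: "F = (a, x)" "length a = d"
    and bd: "\<And>j. j < d \<Longrightarrow> \<bar>x ! j\<bar> \<le> 1 \<and> \<bar>a ! j\<bar> \<le> 1"
    using assms by (auto simp: bounded_signals_def signals_def)
  have "\<bar>moment k F\<bar> \<le> (\<Sum>j<d. \<bar>a ! j * x ! j ^ k\<bar>)"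
    by (simp add: moment_def F sum_abs)
  also have "\<dots> \<le> (\<Sum>j<d. 1)"
    using bd by (intro sum_mono) (auto simp: abs_mult power_abs intro!: mult_le_one power_le_one)
  finally show ?thesis by simp
qed

theorem corollary3p1:
  fixes d l :: nat and \<eta> \<gamma> :: real and F F' :: signal
  assumes "d \<ge> 2"
    and "0 < \<eta>" and "\<eta> \<le> 2 / (real d - 1)"
    and "0 < \<gamma>" and "\<gamma> \<le> 1"
    and "F \<in> bounded_signals d"
    and "regular_signal d \<eta> \<gamma> F"
    and "l < d"
    and "F' \<in> signals l"
  shows "moment_dist d F F' \<ge>
    min 1 (\<eta> ^ (d * (d - 1)) * \<gamma> ^ d * (\<Prod>i = 1..d - 1. (fact i :: real) ^ 2)
           / (sqrt (2 * real d - 1) * real d ^ 2 * fact d * (real d + 1) ^ (d - 1)))"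
proof (cases "moment_dist d F F' \<ge> 1")
  case True
  then show ?thesis by simp
next
  case False
  define \<delta> where "\<delta> = moment_dist d F F'"
  define B where "B = \<eta> ^ (d * (d - 1)) * \<gamma> ^ d * (\<Prod>i = 1..d - 1. (fact i :: real) ^ 2)"
  \<comment> \<open>The factor of \<open>\<delta>\<close> in \<open>abs_det_diff_le\<close> for
    \<open>d\<close> by \<open>d\<close> matrices with entries bounded by
    \<open>M = d + 1\<close>.\<close>
  define K where "K = real d * fact d * (real d + 1) ^ (d - 1)"
  have diff: "\<bar>moment k F - moment k F'\<bar> \<le> \<delta>" if "k \<le> 2 * d - 2" for k
  proof -
    \<comment> \<open>Taking absolute values of the coordinates leaves the norm unchanged and makes
      the bound two-sided.\<close>
    have "\<bar>moment k F - moment k F'\<bar> \<le> L2_set (\<lambda>k. \<bar>moment k F - moment k F'\<bar>) {0..2 * d - 2}"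
      using that by (intro member_le_L2_set) auto
    then show ?thesis
      by (simp add: \<delta>_def moment_dist_def L2_set_def)
  qed
  \<comment> \<open>The nodes and amplitudes of \<open>F'\<close> are unbounded; its moments are
    controlled only through a distance to those of \<open>F\<close> below 1. This is where the 1 in
    the minimum comes from.\<close>
  have "\<bar>moment k F'\<bar> \<le> real d + 1" if "k \<le> 2 * d - 2" for k
    using diff[OF that] abs_moment_le[OF assms(6), of k] False \<delta>_def by linarith
  moreover have "\<bar>moment k F\<bar> \<le> real d + 1" for k
    using abs_moment_le[OF assms(6), of k] by linarith
  ultimately have "\<bar>Determinant.det (hankel d F) - Determinant.det (hankel d F')\<bar> \<le>
      fact d * (real d * \<delta> * (real d + 1) ^ (d - 1))"
    using diff by (intro abs_det_diff_le) (auto simp: hankel_def)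
  \<comment> \<open>The determinant for \<open>F'\<close> vanishes, so the perturbation bound is an
    upper bound for the determinant of \<open>F\<close> itself.\<close>
  then have "B \<le> \<delta> * K"
    using det_hankel_regular_ge[OF assms(7)] assms(2,4) det_hankel_eq_0[OF assms(9,8)]
    by (simp add: B_def K_def mult_ac)
  moreover have "K > 0"
    using assms(1) by (simp add: K_def)
  ultimately have "B / K \<le> \<delta>"
    by (simp add: field_simps)
  \<comment> \<open>The denominator in the theorem is \<open>K\<close> times
    \<open>sqrt (2 * real d - 1) * d\<close>, a factor of at least 1, so the bound
    \<open>B / K\<close> is enough.\<close>
  moreover have "B / (sqrt (2 * real d - 1) * d * K) \<le> B / K"
  proof (rule divide_left_mono)
    have "1 * 1 \<le> sqrt (2 * real d - 1) * d"
      using assms(1) by (intro mult_mono) auto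
    then show "K \<le> sqrt (2 * real d - 1) * d * K"
      using \<open>K > 0\<close> mult_right_mono[of 1 "sqrt (2 * real d - 1) * d" K] by simp
    show "0 < sqrt (2 * real d - 1) * d * K * K"
      using \<open>K > 0\<close> assms(1) by (intro mult_pos_pos) auto
    show "0 \<le> B"
      using assms(2,4) by (auto simp: B_def intro!: mult_nonneg_nonneg prod_nonneg)
  qed
  moreover have "sqrt (2 * real d - 1) * d * K =
      sqrt (2 * real d - 1) * real d ^ 2 * fact d * (real d + 1) ^ (d - 1)"
    by (simp add: K_def power2_eq_square)
  ultimately have "B / (sqrt (2 * real d - 1) * real d ^ 2 * fact d * (real d + 1) ^ (d - 1)) \<le> \<delta>"
    by (simp only: order_trans)
  then show ?thesis
    unfolding \<delta>_def B_def by (rule min.coboundedI2)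
qed

end
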